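(* For every integer $n\geq 1$, $$F_{n}(t)=\frac{(1+t)(1+t^{2})^{n}}{2t}P_{n}^{\mathrm{udr}}\left(\frac{2t}{1+t^{2}}\right).$$ Equivalently, $$P_{n}^{\mathrm{udr}}(t)=\frac{2v}{(1+v)(1+v^{2})^{n}}F_{n}(v),\qquad\text{where } v=\frac{1-\sqrt{1-t^{2}}}{t}.$$
   Context: $\mathfrak{S}_n$ is the set of permutations $\pi=\pi_1\cdots\pi_n$ of $[n]=\{1,\dots,n\}$. An increasing run of $\pi$ is a maximal increasing consecutive subsequence. A birun of $\pi$ is a maximal monotone (increasing or decreasing) consecutive subsequence of length at least two. An up-down run of $\pi$ is either a birun of $\pi$, or the letter $\pi_1$ if it is an increasing run of length $1$; $\mathrm{udr}(\pi)$ is the number of up-down runs of $\pi$. $P_n^{\mathrm{udr}}(t)=\sum_{\pi\in\mathfrak{S}_n}t^{\mathrm{udr}(\pi)}$ for $n\ge1$. $\mathfrak{B}_n$ is the set of signed permutations: permutations $\pi$ of $\{-n,\dots,-1,0,1,\dots,n\}$ with $\pi_{-i}=-\pi_i$ for all $i$ (so $\pi_0=0$), written $\pi=\pi_1\cdots\pi_n$. For $\pi\in\mathfrak{B}_n$: $\mathrm{des}_B(\pi)$ is the number of $i\in\{0,1,\dots,n-1\}$ with $\pi_i>\pi_{i+1}$ (where $\pi_0=0$); the flag descent number $\mathrm{fdes}(\pi)$ is $2\,\mathrm{des}_B(\pi)$ if $\pi_1>0$ and $2\,\mathrm{des}_B(\pi)-1$ if $\pi_1<0$. $F_n(t)=\sum_{\pi\in\mathfrak{B}_n}t^{\mathrm{fdes}(\pi)}$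 for $n\ge1$. In the second identity, $\sqrt{1-t^2}$ is the formal power series in $t$ with constant term $1$, so that $v$ is a formal power series in $t$. *)

theory Defs
  imports
    "HOL-Computational_Algebra.Computational_Algebra"
    "HOL-Combinatorics.Permutations"
begin

section \<open>Up-down runs of permutations\<close>

text \<open>
  A consecutive subsequence of the word \<open>\<pi> 1, \<dots>, \<pi> n\<close> is represented by its set of
  positions, a nonempty interval contained in \<open>{1..n}\<close>.
\<close>

definition consecutive :: "nat \<Rightarrow> nat set \<Rightarrow> bool" where
  "consecutive n I \<longleftrightarrow> (\<exists>i j. 1 \<le> i \<and> i \<le> j \<and> j \<le> n \<and> I = {i..j})"

definition maximal_consecutive :: "nat \<Rightarrow> (nat set \<Rightarrow> bool) \<Rightarrow> nat set \<Rightarrow> bool" where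
  "maximal_consecutive n Q I \<longleftrightarrow>
     consecutive n I \<and> Q I \<and> (\<forall>J. consecutive n J \<and> Q J \<and> I \<subseteq> J \<longrightarrow> J = I)"

definition increasing_run :: "nat \<Rightarrow> (nat \<Rightarrow> nat) \<Rightarrow> nat set \<Rightarrow> bool" where
  "increasing_run n \<pi> = maximal_consecutive n (\<lambda>I. strict_mono_on I \<pi>)"

definition birun :: "nat \<Rightarrow> (nat \<Rightarrow> nat) \<Rightarrow> nat set \<Rightarrow> bool" where
  "birun n \<pi> I \<longleftrightarrow>
     maximal_consecutive n (\<lambda>I. strict_mono_on I \<pi> \<or> strict_antimono_on I \<pi>) I \<and> 2 \<le> card I"

definition updown_run :: "nat \<Rightarrow> (nat \<Rightarrow> nat) \<Rightarrow> nat set \<Rightarrow> bool" where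
  "updown_run n \<pi> I \<longleftrightarrow> birun n \<pi> I \<or> (I = {1} \<and> increasing_run n \<pi> I)"

definition udr :: "nat \<Rightarrow> (nat \<Rightarrow> nat) \<Rightarrow> nat" where
  "udr n \<pi> = card {I. updown_run n \<pi> I}"

definition udr_poly :: "nat \<Rightarrow> int poly" where
  "udr_poly n = (\<Sum>\<pi> | \<pi> permutes {1..n}. monom 1 (udr n \<pi>))"


section \<open>Flag descents of signed permutations\<close>

definition signed_perms :: "nat \<Rightarrow> (int \<Rightarrow> int) set" where
  "signed_perms n =
     {\<pi>. \<pi> permutes {- int n..int n} \<and> (\<forall>i\<in>{- int n..int n}. \<pi> (- i) = - \<pi> i)}"

text \<open>The index \<open>0\<close> is included in the descents; oddness of \<open>\<pi>\<close> gives \<open>\<pi> 0 = 0\<close>.\<close>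

definition des_B :: "nat \<Rightarrow> (int \<Rightarrow> int) \<Rightarrow> nat" where
  "des_B n \<pi> = card {i \<in> {0..<int n}. \<pi> i > \<pi> (i + 1)}"

text \<open>
  The subtraction on natural numbers does not truncate for \<open>n \<ge> 1\<close>: if \<open>\<pi> 1 < 0\<close> then \<open>0\<close> is a
  descent (see \<open>des_B_pos\<close> below).
\<close>

definition fdes :: "nat \<Rightarrow> (int \<Rightarrow> int) \<Rightarrow> nat" where
  "fdes n \<pi> = (if \<pi> 1 > 0 then 2 * des_B n \<pi> else 2 * des_B n \<pi> - 1)"

definition fdes_poly :: "nat \<Rightarrow> int poly" where
  "fdes_poly n = (\<Sum>\<pi>\<in>signed_perms n. monom 1 (fdes n \<pi>))"

lemma des_B_pos:
  assumes "n \<ge> 1" "\<pi> \<in> signed_perms n" "\<pi> 1 < 0"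
  shows "des_B n \<pi> \<ge> 1"
proof -
  have "\<pi> (- 0) = - \<pi> 0"
    using assms(2) unfolding signed_perms_def by fastforce
  then have "0 \<in> {i \<in> {0..<int n}. \<pi> i > \<pi> (i + 1)}"
    using assms by auto
  moreover have "finite {i \<in> {0..<int n}. \<pi> i > \<pi> (i + 1)}"
    by (rule finite_subset [of _ "{0..<int n}"]) auto
  ultimately show ?thesis
    unfolding des_B_def by (metis One_nat_def Suc_leI card_gt_0_iff empty_iff)
qed


section \<open>Substitution into integer polynomials\<close>

text \<open>The value of an integer polynomial at an element of an arbitrary commutative ring.\<close>

definition subst_poly :: "int poly \<Rightarrow> 'a::comm_ring_1 \<Rightarrow> 'a" where
  "subst_poly p x = poly (map_poly of_int p) x"

text \<open>The indeterminate \<open>t\<close> of the field of rational functions in one variable over the reals.\<close>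

definition ratfun_X :: "real poly fract" where
  "ratfun_X = Fraction_Field.Fract [:0, 1:] 1"

text \<open>
  The series \<open>sqrt (1 - t\<^sup>2)\<close> with constant term \<open>1\<close>, and \<open>v = (1 - sqrt (1 - t\<^sup>2)) / t\<close>.
  Division by \<open>fps_X\<close> drops the constant coefficient, which is zero here, so it is exact;
  the lemmas below confirm both readings.
\<close>

definition sqrt_series :: "real fps" where
  "sqrt_series = fps_radical root 2 (1 - fps_X ^ 2)"

definition v_series :: "real fps" where
  "v_series = (1 - sqrt_series) / fps_X"

lemma sqrt_series_nth_0: "fps_nth sqrt_series 0 = 1"
  by (simp add: sqrt_series_def)

lemma sqrt_series_square: "sqrt_series ^ 2 = 1 - fps_X ^ 2"
proof -
  have "fps_radical root (Suc 1) (1 - fps_X ^ 2) ^ Suc 1 = (1 - fps_X ^ 2 :: real fps)"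
    by (subst power_radical [symmetric]) auto
  then show ?thesis
    by (simp add: sqrt_series_def numeral_2_eq_2)
qed

lemma v_series_times_X: "fps_X * v_series = 1 - sqrt_series"
proof -
  have "fps_X dvd 1 - sqrt_series"
    by (cases "1 - sqrt_series = 0")
       (auto simp: fps_dvd_iff sqrt_series_nth_0 intro!: Suc_leI subdegree_geI
             simp flip: One_nat_def)
  then show ?thesis
    unfolding v_series_def by (rule dvd_mult_div_cancel)
qed

end

theory Submission
  imports Defs
begin

text \<open>
  A signed permutation is a permutation \<open>\<tau>\<close> of \<open>{1..n}\<close> together with the set \<open>S\<close> of positions
  carrying a minus sign. A descent is decided by the sign of the entry that is larger in absolute
  value, so for fixed \<open>\<tau>\<close> the sum over \<open>S\<close> of \<open>t\<close> to the flag descent number is a product over the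
  positions. With \<open>\<tau> 0 = 0\<close> and \<open>\<tau> (n + 1) = n + 1\<close>, each position in \<open>{2..n}\<close> contributes \<open>2 * t\<close>
  if \<open>\<tau>\<close> turns there and \<open>1 + t\<^sup>2\<close> otherwise, and the first position contributes \<open>1 + t\<close>.
  Reverse-complementation of \<open>\<tau>\<close> moves the turns to positions in \<open>{1..<n}\<close>, and there the number of
  turns is one less than the number of up-down runs.
\<close>

text \<open>
  The position \<open>n\<close> always belongs to \<open>turns n \<pi>\<close>, which is thus the set of right end points of
  the up-down runs of \<open>\<pi>\<close>.
\<close>

definition turns :: "nat \<Rightarrow> (nat \<Rightarrow> nat) \<Rightarrow> nat set" where
  "turns n \<pi> = {j \<in> {1..n}. j = n \<or> (\<pi> (j - 1) < \<pi> j) \<noteq> (\<pi> j < \<pi> (Suc j))}"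

section \<open>Up-down runs counted by turns\<close>

lemma strict_mono_on_interval_iff:
  fixes f :: "nat \<Rightarrow> 'a::order"
  shows "strict_mono_on {i..j} f \<longleftrightarrow> (\<forall>k\<in>{i..<j}. f k < f (Suc k))"
proof
  assume L: "\<forall>k\<in>{i..<j}. f k < f (Suc k)"
  have "f a < f b" if "i \<le> a" "Suc a \<le> b" "b \<le> j" for a b
    using that(2,3)
  proof (induction b rule: dec_induct)
    case base
    then show ?case using L that(1) by simp
  next
    case (step m)
    then have "f m < f (Suc m)" using L that(1) by simp
    with step show ?case by (meson Suc_leD less_trans)
  qed
  then show "strict_mono_on {i..j} f"
    by (auto simp: strict_mono_on_def)
qed (auto simp: strict_mono_on_def)

lemma strict_antimono_on_interval_iff:
  fixes f :: "nat \<Rightarrow> nat"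
  shows "strict_antimono_on {i..j} f \<longleftrightarrow> (\<forall>k\<in>{i..<j}. f (Suc k) < f k)"
proof -
  \<comment> \<open>Negation in \<open>int\<close> turns decreasing into increasing; the preceding
    lemma is stated for arbitrary orders so that it applies to the negated function.\<close>
  have "strict_antimono_on {i..j} f \<longleftrightarrow> strict_mono_on {i..j} (\<lambda>k. - int (f k))"
    by (auto simp: monotone_on_def)
  then show ?thesis
    by (simp add: strict_mono_on_interval_iff)
qed

text \<open>Injectivity rules out equal neighbours, so every adjacent pair has one of two
  directions. A single Boolean \<open>b\<close> for the common direction lets both kinds of birun be
  treated at once.\<close>

lemma monotone_interval_iff:
  assumes "inj (\<pi> :: nat \<Rightarrow> nat)"
  shows "strict_mono_on {i..j} \<pi> \<or> strict_antimono_on {i..j} \<pi> \<longleftrightarrow>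
    (\<exists>b. \<forall>k\<in>{i..<j}. (\<pi> k < \<pi> (Suc k)) = b)"
proof -
  have "\<pi> (Suc k) < \<pi> k \<longleftrightarrow> \<not> \<pi> k < \<pi> (Suc k)" for k
    using inj_eq[OF assms, of k "Suc k"] by auto
  then show ?thesis
    unfolding strict_mono_on_interval_iff strict_antimono_on_interval_iff by (metis (full_types))
qed

text \<open>Monotonicity passes to subintervals, so maximality need only be tested against
  extensions by one position to the left or to the right. This makes being a birun a local condition
  on ascents.\<close>

lemma birun_iff:
  assumes "inj \<pi>"
  shows "birun n \<pi> I \<longleftrightarrow> (\<exists>i j b. 1 \<le> i \<and> i < j \<and> j \<le> n \<and> I = {i..j} \<and>
    (\<forall>k\<in>{i..<j}. (\<pi> k < \<pi> (Suc k)) = b) \<and>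
    (i = 1 \<or> (\<pi> (i - 1) < \<pi> i) \<noteq> b) \<and> (j = n \<or> (\<pi> j < \<pi> (Suc j)) \<noteq> b))"
    (is "_ \<longleftrightarrow> ?R")
proof
  assume "birun n \<pi> I"
  then have c: "consecutive n I" and m: "strict_mono_on I \<pi> \<or> strict_antimono_on I \<pi>"
    and mx: "\<And>J. consecutive n J \<Longrightarrow> strict_mono_on J \<pi> \<or> strict_antimono_on J \<pi> \<Longrightarrow> I \<subseteq> J \<Longrightarrow> J = I"
    and two: "2 \<le> card I"
    unfolding birun_def maximal_consecutive_def by blast+
  obtain i j where ij: "1 \<le> i" "i \<le> j" "j \<le> n" "I = {i..j}"
    using c unfolding consecutive_def by blast
  have "i < j" using two ij by (cases "i = j") auto
  obtain b where b: "\<forall>k\<in>{i..<j}. (\<pi> k < \<pi> (Suc k)) = b"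
    using m unfolding ij monotone_interval_iff[OF assms] by blast
  have 1: "i = 1 \<or> (\<pi> (i - 1) < \<pi> i) \<noteq> b"
  proof (rule ccontr)
    assume H: "\<not> ?thesis"
    have "(\<pi> k < \<pi> (Suc k)) = b" if "k \<in> {i - 1..<j}" for k
    proof -
      have "k = i - 1 \<and> Suc k = i \<or> k \<in> {i..<j}" using that ij by auto
      then show ?thesis using H b by auto
    qed
    then have "strict_mono_on {i - 1..j} \<pi> \<or> strict_antimono_on {i - 1..j} \<pi>"
      unfolding monotone_interval_iff[OF assms] by blast
    moreover have "1 \<le> i - 1" "i - 1 \<le> j" using H ij by auto
    then have "consecutive n {i - 1..j}" using ij unfolding consecutive_def by blast
    ultimately have "{i - 1..j} = I" using ij by (intro mx) auto
    then have "i - 1 \<in> {i..j}" using ij by auto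
    then show False using ij(1) by auto
  qed
  have 2: "j = n \<or> (\<pi> j < \<pi> (Suc j)) \<noteq> b"
  proof (rule ccontr)
    assume H: "\<not> ?thesis"
    then have "\<forall>k\<in>{i..<Suc j}. (\<pi> k < \<pi> (Suc k)) = b"
      using b by (auto simp: less_Suc_eq)
    then have "{i..Suc j} = I"
      using H ij by (intro mx) (auto simp: monotone_interval_iff[OF assms] consecutive_def
          simp del: atLeastLessThanSuc)
    then have "Suc j \<in> {i..j}" using ij by auto
    then show False by auto
  qed
  show ?R using ij \<open>i < j\<close> b 1 2 by blast
next
  assume ?R
  then obtain i j b where ij: "1 \<le> i" "i < j" "j \<le> n" "I = {i..j}"
    and b: "\<forall>k\<in>{i..<j}. (\<pi> k < \<pi> (Suc k)) = b"
    and 1: "i = 1 \<or> (\<pi> (i - 1) < \<pi> i) \<noteq> b" and 2: "j = n \<or> (\<pi> j < \<pi> (Suc j)) \<noteq> b"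
    by blast
  have "J = I" if J: "consecutive n J" "strict_mono_on J \<pi> \<or> strict_antimono_on J \<pi>" "I \<subseteq> J" for J
  proof -
    obtain p q where pq: "1 \<le> p" "q \<le> n" "J = {p..q}"
      using J(1) unfolding consecutive_def by blast
    then have sub: "p \<le> i" "j \<le> q" using J(3) ij by auto
    obtain c where c: "\<forall>k\<in>{p..<q}. (\<pi> k < \<pi> (Suc k)) = c"
      using J(2) unfolding pq monotone_interval_iff[OF assms] by blast
    \<comment> \<open>The position \<open>i\<close> belongs to both index ranges because
      \<open>i < j\<close>, so the larger interval must run in the same direction.\<close>
    have "c = b" using c b sub ij by (metis atLeastLessThan_iff le_refl less_le_trans)
    have "\<not> p < i"
    proof
      assume "p < i"
      then have "i - 1 \<in> {p..<q}" "i \<noteq> 1" "Suc (i - 1) = i" using sub ij pq by auto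
      then show False using c 1 \<open>c = b\<close> by metis
    qed
    moreover have "\<not> j < q"
    proof
      assume "j < q"
      then have "j \<in> {p..<q}" "j \<noteq> n" using sub ij pq by auto
      then show False using c 2 \<open>c = b\<close> by metis
    qed
    ultimately show ?thesis using sub pq ij by auto
  qed
  moreover have "consecutive n I" using ij unfolding consecutive_def by (metis less_imp_le)
  moreover have "strict_mono_on I \<pi> \<or> strict_antimono_on I \<pi>"
    unfolding ij(4) monotone_interval_iff[OF assms] using b by blast
  moreover have "2 \<le> card I" using ij by simp
  ultimately show "birun n \<pi> I" unfolding birun_def maximal_consecutive_def by blast
qed

lemma increasing_run_singleton_iff:
  assumes "n \<ge> 1"
  shows "increasing_run n \<pi> {1} \<longleftrightarrow> n = 1 \<or> \<not> \<pi> 1 < \<pi> 2"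
proof
  assume R: "increasing_run n \<pi> {1}"
  show "n = 1 \<or> \<not> \<pi> 1 < \<pi> 2"
  proof (rule ccontr)
    assume H: "\<not> ?thesis"
    have "consecutive n {1..2}" using H assms unfolding consecutive_def
      by (intro exI[of _ 1] exI[of _ 2]) auto
    moreover have "strict_mono_on {1..2} \<pi>"
      unfolding strict_mono_on_interval_iff using H
      by (auto simp: numeral_2_eq_2 le_less_Suc_eq less_Suc_eq_le)
    ultimately have "{1..2} = {1::nat}"
      using R unfolding increasing_run_def maximal_consecutive_def by auto
    then have "(2::nat) \<in> {1}" by (metis atLeastAtMost_iff le_refl one_le_numeral)
    then show False by simp
  qed
next
  assume H: "n = 1 \<or> \<not> \<pi> 1 < \<pi> 2"
  have "J = {1}" if J: "consecutive n J" "strict_mono_on J \<pi>" "{1} \<subseteq> J" for J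
  proof -
    obtain p q where pq: "1 \<le> p" "q \<le> n" "J = {p..q}"
      using J(1) unfolding consecutive_def by blast
    have p: "p = 1" "1 \<le> q" using J(3) pq by auto
    have "\<not> 1 < q"
    proof
      assume "1 < q"
      then have "1 \<in> {p..<q}" using p by simp
      then have "\<pi> 1 < \<pi> (Suc 1)"
        using J(2) unfolding pq strict_mono_on_interval_iff by blast
      then show False using H \<open>1 < q\<close> pq by (simp add: numeral_2_eq_2)
    qed
    then show ?thesis using pq p by auto
  qed
  moreover have "consecutive n {1}" using assms unfolding consecutive_def
    by (intro exI[of _ 1]) auto
  moreover have "strict_mono_on {1} \<pi>" by (simp add: monotone_on_def)
  ultimately show "increasing_run n \<pi> {1}"
    unfolding increasing_run_def maximal_consecutive_def by blast
qed

lemma permutes_interval_0: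
  assumes "\<pi> permutes {1..n::nat}" shows "\<pi> 0 = 0"
  using assms by (auto simp: permutes_def)

lemma permutes_interval_Suc:
  assumes "\<pi> permutes {1..n::nat}" shows "\<pi> (Suc n) = Suc n"
  using assms by (auto simp: permutes_def)

lemma permutes_interval_range:
  assumes "\<pi> permutes {1..n::nat}" "1 \<le> i" "i \<le> n" shows "1 \<le> \<pi> i" "\<pi> i \<le> n"
  using permutes_in_image[OF assms(1), of i] assms(2,3) by auto

lemma Max_interval: "i \<le> j \<Longrightarrow> Max {i..j} = (j::nat)"
  by (rule Max_eqI) auto

text \<open>Sending a run to its right end is a bijection onto the turns. The direction of its last
  step determines how far a birun reaches to the left, and conversely every turn
  \<open>j > 1\<close> ends the birun obtained by going left from \<open>j\<close> while the
  direction persists.\<close>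

theorem udr_eq_card_turns:
  assumes "n \<ge> 1" "\<pi> permutes {1..n}"
  shows "udr n \<pi> = card (turns n \<pi>)"
proof -
  note inj = permutes_inj[OF assms(2)]
  have up0: "\<pi> 0 < \<pi> (Suc 0)"
    using permutes_interval_0[OF assms(2)] permutes_interval_range[OF assms(2), of 1] assms(1)
    by simp
  \<comment> \<open>Since \<pi> 0 = 0, position 1 is always entered by an ascent. It is therefore a
    turn exactly when the one-letter run \<open>{1}\<close> counts as an up-down run.\<close>
  have sing: "increasing_run n \<pi> {1} \<longleftrightarrow> 1 \<in> turns n \<pi>"
    unfolding increasing_run_singleton_iff[OF assms(1)] turns_def using up0 assms(1)
    by (auto simp: numeral_2_eq_2)
  have "bij_betw Max {I. updown_run n \<pi> I} (turns n \<pi>)"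
  proof (rule bij_betwI')
    fix I J assume "I \<in> {I. updown_run n \<pi> I}" "J \<in> {I. updown_run n \<pi> I}"
    then have IJ: "updown_run n \<pi> I" "updown_run n \<pi> J" by auto
    have "I = J" if eq: "Max I = Max J"
    proof (cases "birun n \<pi> I \<and> birun n \<pi> J")
      case True
      obtain i j b where I: "1 \<le> i" "i < j" "I = {i..j}"
        "\<forall>k\<in>{i..<j}. (\<pi> k < \<pi> (Suc k)) = b" "i = 1 \<or> (\<pi> (i - 1) < \<pi> i) \<noteq> b"
        using True unfolding birun_iff[OF inj] by blast
      obtain p q c where J: "1 \<le> p" "p < q" "J = {p..q}"
        "\<forall>k\<in>{p..<q}. (\<pi> k < \<pi> (Suc k)) = c" "p = 1 \<or> (\<pi> (p - 1) < \<pi> p) \<noteq> c"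
        using True unfolding birun_iff[OF inj] by blast
      have "Max I = j" "Max J = q" using I(2,3) J(2,3) by (simp_all add: Max_interval)
      then have "j = q" using eq by simp
      \<comment> \<open>Both biruns contain the last adjacent pair before the common right end,
        which forces equal directions.\<close>
      have "j - 1 \<in> {i..<j}" "j - 1 \<in> {p..<q}" using I J \<open>j = q\<close> by auto
      then have "b = c" using I(4) J(4) by metis
      have "\<not> i < p"
      proof
        assume "i < p"
        then have "p - 1 \<in> {i..<j}" "p \<noteq> 1" "Suc (p - 1) = p" using I J \<open>j = q\<close> by auto
        then show False using I(4) J(5) \<open>b = c\<close> by metis
      qed
      moreover have "\<not> p < i"
      proof
        assume "p < i"
        then have "i - 1 \<in> {p..<q}" "i \<noteq> 1" "Suc (i - 1) = i" using I J \<open>j = q\<close> by auto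
        then show False using J(4) I(5) \<open>b = c\<close> by metis
      qed
      ultimately show ?thesis using I J \<open>j = q\<close> by auto
    next
      case False
      \<comment> \<open>A birun has at least two positions and so never ends at 1; only
        \<open>{1}\<close> does.\<close>
      have "Max K \<noteq> 1" if "birun n \<pi> K" for K
        using that unfolding birun_iff[OF inj] by (auto simp: Max_interval)
      then show ?thesis using False IJ eq unfolding updown_run_def by (metis Max_singleton)
    qed
    then show "(Max I = Max J) = (I = J)" by blast
  next
    fix I assume "I \<in> {I. updown_run n \<pi> I}"
    then consider "birun n \<pi> I" | "I = {1}" "increasing_run n \<pi> {1}"
      unfolding updown_run_def by blast
    then show "Max I \<in> turns n \<pi>"
    proof cases
      case 1
      then obtain i j b where I: "1 \<le> i" "i < j" "j \<le> n" "I = {i..j}"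
        "\<forall>k\<in>{i..<j}. (\<pi> k < \<pi> (Suc k)) = b" "j = n \<or> (\<pi> j < \<pi> (Suc j)) \<noteq> b"
        unfolding birun_iff[OF inj] by blast
      have "j - 1 \<in> {i..<j}" "Suc (j - 1) = j" using I by auto
      then have "(\<pi> (j - 1) < \<pi> j) = b" using I(5) by metis
      then show ?thesis using I unfolding turns_def by (auto simp: Max_interval)
    next
      case 2
      then show ?thesis using sing by simp
    qed
  next
    fix j assume j: "j \<in> turns n \<pi>"
    show "\<exists>I\<in>{I. updown_run n \<pi> I}. j = Max I"
    proof (cases "j = 1")
      case True
      then have "updown_run n \<pi> {1}" using sing j unfolding updown_run_def by simp
      then show ?thesis using True by (intro bexI[of _ "{1}"]) simp_all
    next
      case False
      have j2: "1 < j" "j \<le> n" using j False unfolding turns_def by auto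
      define b where "b = (\<pi> (j - 1) < \<pi> j)"
      define Q where "Q i \<longleftrightarrow> 1 \<le> i \<and> i < j \<and> (\<forall>k\<in>{i..<j}. (\<pi> k < \<pi> (Suc k)) = b)" for i
      \<comment> \<open>The leftmost start from which all steps up to \<open>j\<close> keep the
        direction \<open>b\<close>; leastness gives maximality on the left.\<close>
      define i where "i = (LEAST i. Q i)"
      have "Q (j - 1)"
      proof -
        have "k = j - 1 \<and> Suc k = j" if "k \<in> {j - 1..<j}" for k using that by auto
        then have "\<forall>k\<in>{j - 1..<j}. (\<pi> k < \<pi> (Suc k)) = b" unfolding b_def by metis
        then show ?thesis using j2 unfolding Q_def by auto
      qed
      then have Qi: "Q i" unfolding i_def by (rule LeastI)
      have "i = 1 \<or> (\<pi> (i - 1) < \<pi> i) \<noteq> b"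
      proof (rule ccontr)
        assume H: "\<not> ?thesis"
        have "Q (i - 1)"
          unfolding Q_def
        proof (intro conjI ballI)
          fix k assume "k \<in> {i - 1..<j}"
          then have "k = i - 1 \<or> k \<in> {i..<j}" by auto
          then show "(\<pi> k < \<pi> (Suc k)) = b" using H Qi unfolding Q_def by auto
        qed (use H Qi in \<open>auto simp: Q_def\<close>)
        then have "i \<le> i - 1" unfolding i_def by (rule Least_le)
        then show False using Qi unfolding Q_def by auto
      qed
      moreover have "j = n \<or> (\<pi> j < \<pi> (Suc j)) \<noteq> b"
        using j unfolding turns_def b_def by auto
      ultimately have "birun n \<pi> {i..j}"
        using Qi j2 unfolding birun_iff[OF inj] Q_def by blast
      moreover have "Max {i..j} = j" using Qi unfolding Q_def by (simp add: Max_interval)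
      ultimately show ?thesis unfolding updown_run_def by (metis mem_Collect_eq)
    qed
  qed
  then show ?thesis unfolding udr_def by (rule bij_betw_same_card)
qed

section \<open>Signed permutations as permutations with a set of negative positions\<close>

text \<open>The factor \<open>sgn i\<close> extends the signed word from positive positions to an
  odd function on all integers, with value 0 at 0.\<close>

definition signed_of :: "(nat \<Rightarrow> nat) \<Rightarrow> nat set \<Rightarrow> int \<Rightarrow> int" where
  "signed_of \<tau> S i = sgn i * (if nat \<bar>i\<bar> \<in> S then - 1 else 1) * int (\<tau> (nat \<bar>i\<bar>))"

lemma signed_of_pos:
  "0 < k \<Longrightarrow> signed_of \<tau> S (int k) = (if k \<in> S then - int (\<tau> k) else int (\<tau> k))"
  by (simp add: signed_of_def)

lemma signed_of_0 [simp]: "signed_of \<tau> S 0 = 0"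
  by (simp add: signed_of_def)

lemma signed_of_uminus: "signed_of \<tau> S (- i) = - signed_of \<tau> S i"
  by (simp add: signed_of_def)

lemma signed_of_in_signed_perms:
  assumes "\<tau> permutes {1..n}" "S \<subseteq> {1..n}"
  shows "signed_of \<tau> S \<in> signed_perms n"
proof -
  have rng: "1 \<le> \<tau> k \<and> \<tau> k \<le> n" if "1 \<le> k" "k \<le> n" for k
    using permutes_interval_range[OF assms(1) that] by blast
  have fixp: "signed_of \<tau> S i = i" if "i \<notin> {- int n..int n}" for i
  proof -
    have "nat \<bar>i\<bar> \<notin> {1..n}" using that by auto
    then have "nat \<bar>i\<bar> \<notin> S" "\<tau> (nat \<bar>i\<bar>) = nat \<bar>i\<bar>"
      using assms by (auto simp: permutes_def)
    then show ?thesis by (simp add: signed_of_def sgn_if)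
  qed
  have maps: "signed_of \<tau> S i \<in> {- int n..int n}" if i: "i \<in> {- int n..int n}" for i
  proof (cases "i = 0")
    case False
    then have "\<tau> (nat \<bar>i\<bar>) \<le> n" using rng[of "nat \<bar>i\<bar>"] i by auto
    then show ?thesis by (auto simp: signed_of_def sgn_if)
  qed auto
  have inj: "inj_on (signed_of \<tau> S) {- int n..int n}"
  proof (rule inj_onI)
    fix x y assume x: "x \<in> {- int n..int n}" and y: "y \<in> {- int n..int n}"
      and eq: "signed_of \<tau> S x = signed_of \<tau> S y"
    \<comment> \<open>Absolute values recover \<tau>, so equal values force x = y or x = -y. In the
      second case oddness makes the common value 0, which occurs only at 0.\<close>
    have z: "\<bar>signed_of \<tau> S u\<bar> = int (\<tau> (nat \<bar>u\<bar>))" for u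
      using permutes_interval_0[OF assms(1)] by (auto simp: signed_of_def abs_mult sgn_if)
    have "\<tau> (nat \<bar>x\<bar>) = \<tau> (nat \<bar>y\<bar>)" using z[of x] z[of y] eq by simp
    then have "nat \<bar>x\<bar> = nat \<bar>y\<bar>" using permutes_inj[OF assms(1)] by (simp add: inj_eq)
    then have a: "x = y \<or> x = - y" by linarith
    have "x = y" if "x = - y"
    proof -
      have "signed_of \<tau> S y = 0" using eq that by (simp add: signed_of_uminus)
      then have "\<tau> (nat \<bar>y\<bar>) = 0" using z[of y] by simp
      moreover have "nat \<bar>y\<bar> \<le> n" using y by auto
      ultimately have "y = 0" using rng[of "nat \<bar>y\<bar>"] by linarith
      then show ?thesis using that by simp
    qed
    then show "x = y" using a by blast
  qed
  have "signed_of \<tau> S ` {- int n..int n} = {- int n..int n}"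
    by (intro endo_inj_surj[OF _ _ inj] image_subsetI maps) simp_all
  then have "bij_betw (signed_of \<tau> S) {- int n..int n} {- int n..int n}"
    using inj unfolding bij_betw_def by blast
  then have "signed_of \<tau> S permutes {- int n..int n}"
    using fixp by (rule bij_imp_permutes)
  then show ?thesis by (simp add: signed_perms_def signed_of_uminus)
qed

lemma signed_perms_properties:
  assumes "\<pi> \<in> signed_perms n"
  shows "inj \<pi>" "\<pi> (- i) = - \<pi> i" "\<pi> 0 = 0"
    and "i \<notin> {- int n..int n} \<Longrightarrow> \<pi> i = i" "i \<in> {- int n..int n} \<Longrightarrow> \<bar>\<pi> i\<bar> \<le> int n"
proof -
  have p: "\<pi> permutes {- int n..int n}" and o: "\<forall>i\<in>{- int n..int n}. \<pi> (- i) = - \<pi> i"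
    using assms unfolding signed_perms_def by auto
  show "inj \<pi>" using p by (rule permutes_inj)
  show "i \<notin> {- int n..int n} \<Longrightarrow> \<pi> i = i" for i using p by (auto simp: permutes_def)
  then show "\<pi> (- i) = - \<pi> i" for i
    using o by (cases "i \<in> {- int n..int n}") auto
  from this[of 0] show "\<pi> 0 = 0" by simp
  show "i \<in> {- int n..int n} \<Longrightarrow> \<bar>\<pi> i\<bar> \<le> int n" for i
    using permutes_in_image[OF p, of i] by auto
qed

lemma abs_of_permutes:
  assumes "\<pi> \<in> signed_perms n"
  shows "(\<lambda>k. nat \<bar>\<pi> (int k)\<bar>) permutes {1..n}"
proof -
  note P = signed_perms_properties[OF assms]
  let ?\<tau> = "\<lambda>k. nat \<bar>\<pi> (int k)\<bar>"
  have fixp: "?\<tau> k = k" if "k \<notin> {1..n}" for k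
    using that P(3) P(4)[of "int k"] by (cases "k = 0") auto
  have nz: "\<pi> i \<noteq> 0" if "i \<noteq> 0" for i
    using that inj_eq[OF P(1), of i 0] P(3) by simp
  have inj: "inj_on ?\<tau> {1..n}"
  proof (rule inj_onI)
    fix x y assume xy: "x \<in> {1..n}" "y \<in> {1..n}" "?\<tau> x = ?\<tau> y"
    then have "\<pi> (int x) = \<pi> (int y) \<or> \<pi> (int x) = \<pi> (- int y)"
      using P(2)[of "int y"] by linarith
    then have "int x = int y \<or> int x = - int y" using P(1) by (simp add: inj_eq)
    then show "x = y" using xy by auto
  qed
  have "?\<tau> k \<in> {1..n}" if "k \<in> {1..n}" for k
  proof -
    have "\<bar>\<pi> (int k)\<bar> \<le> int n" using that by (intro P(5)) auto
    moreover have "\<pi> (int k) \<noteq> 0" using that by (intro nz) auto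
    ultimately show ?thesis by auto
  qed
  then have "?\<tau> ` {1..n} = {1..n}" using inj by (intro endo_inj_surj) auto
  then show ?thesis using inj fixp by (intro bij_imp_permutes) (auto simp: bij_betw_def)
qed

text \<open>The inverse of \<open>signed_of\<close> takes the absolute values of the entries at
  positive positions and the set of positions in \<open>{1..n}\<close> with negative entries;
  oddness determines the rest.\<close>

lemma sum_signed_perms:
  fixes f :: "(int \<Rightarrow> int) \<Rightarrow> 'a::comm_monoid_add"
  shows "(\<Sum>\<pi>\<in>signed_perms n. f \<pi>) =
    (\<Sum>\<tau> | \<tau> permutes {1..n}. \<Sum>S\<in>Pow {1..n}. f (signed_of \<tau> S))"
proof -
  let ?A = "{\<tau>. \<tau> permutes {1..n}}"
  define inv where "inv \<pi> = (\<lambda>k. nat \<bar>\<pi> (int k)\<bar>, {k \<in> {1..n}. \<pi> (int k) < 0})"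
    for \<pi> :: "int \<Rightarrow> int"
  have "(\<Sum>\<pi>\<in>signed_perms n. f \<pi>) = (\<Sum>p\<in>?A \<times> Pow {1..n}. f (case_prod signed_of p))"
  proof (rule sum.reindex_bij_witness[where i = "case_prod signed_of" and j = inv])
    fix \<pi> assume \<pi>: "\<pi> \<in> signed_perms n"
    note P = signed_perms_properties[OF \<pi>]
    have pos: "case_prod signed_of (inv \<pi>) (int k) = \<pi> (int k)" for k
    proof (cases "k = 0")
      case False
      then have "k \<notin> {1..n} \<Longrightarrow> \<pi> (int k) = int k" by (intro P(4)) auto
      then show ?thesis using False
        by (auto simp: inv_def signed_of_pos)
    qed (simp add: inv_def P(3))
    show "case_prod signed_of (inv \<pi>) = \<pi>"
    proof
      fix i
      show "case_prod signed_of (inv \<pi>) i = \<pi> i"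
      proof (cases i rule: int_cases2)
        case (nonneg k)
        then show ?thesis using pos by simp
      next
        case (nonpos k)
        then show ?thesis using pos[of k] P(2)[of "int k"]
          by (simp add: split_beta signed_of_uminus)
      qed
    qed
    then show "f (case_prod signed_of (inv \<pi>)) = f \<pi>" by simp
    show "inv \<pi> \<in> ?A \<times> Pow {1..n}" using abs_of_permutes[OF \<pi>] by (auto simp: inv_def)
  next
    fix p assume "p \<in> ?A \<times> Pow {1..n}"
    then obtain \<tau> S where p: "p = (\<tau>, S)" "\<tau> permutes {1..n}" "S \<subseteq> {1..n}" by auto
    then show "case_prod signed_of p \<in> signed_perms n"
      by (simp add: signed_of_in_signed_perms)
    have "nat \<bar>signed_of \<tau> S (int k)\<bar> = \<tau> k" for k
      using permutes_interval_0[OF p(2)] by (cases "k = 0") (auto simp: signed_of_pos)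
    moreover have "signed_of \<tau> S (int k) < 0 \<longleftrightarrow> k \<in> S" if "k \<in> {1..n}" for k
      using that permutes_interval_range[OF p(2), of k] by (auto simp: signed_of_pos)
    ultimately show "inv (case_prod signed_of p) = p"
      using p by (auto simp: inv_def)
  qed
  also have "\<dots> = (\<Sum>\<tau>\<in>?A. \<Sum>S\<in>Pow {1..n}. f (signed_of \<tau> S))"
    by (simp add: sum.cartesian_product split_beta)
  finally show ?thesis .
qed

section \<open>Summing over the signs of a fixed permutation\<close>

lemma signed_of_descent_iff:
  assumes "\<tau> permutes {1..n}" "S \<subseteq> {1..n}" "k < n"
  shows "signed_of \<tau> S (int k) > signed_of \<tau> S (int k + 1) \<longleftrightarrow>
    (if \<tau> k < \<tau> (Suc k) then Suc k \<in> S else k \<notin> S)"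
proof -
  have e: "int k + 1 = int (Suc k)" by simp
  have r: "1 \<le> \<tau> (Suc k)" using permutes_interval_range[OF assms(1), of "Suc k"] assms(3) by simp
  have ne: "\<tau> k \<noteq> \<tau> (Suc k)" using permutes_inj[OF assms(1)] by (simp add: inj_eq)
  show ?thesis
  proof (cases "k = 0")
    case True
    then show ?thesis using r permutes_interval_0[OF assms(1)]
      unfolding e signed_of_pos[OF zero_less_Suc] by auto
  next
    case False
    then have "1 \<le> \<tau> k" using permutes_interval_range[OF assms(1), of k] assms(3) by simp
    then show ?thesis using r ne False
      unfolding e signed_of_pos[OF zero_less_Suc] by (auto simp: signed_of_pos)
  qed
qed

text \<open>Each signed descent \<open>k\<close> is charged to the position of the entry larger in
  absolute value: \<open>Suc k\<close> if \<tau> ascends at \<open>k\<close>, and \<open>k\<close>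
  otherwise. A position in \<open>S\<close> is then charged only from its left, a position outside
  \<open>S\<close> only from its right, and the power splits into factors for single
  positions.\<close>

lemma power_fdes_signed_of:
  fixes x :: "'a::comm_ring_1"
  assumes "n \<ge> 1" "\<tau> permutes {1..n}" "S \<subseteq> {1..n}"
  defines "up \<equiv> \<lambda>k. \<tau> k < \<tau> (Suc k)"
  defines "c \<equiv> \<lambda>k. if k = 1 then x else x ^ 2"
  shows "x ^ fdes n (signed_of \<tau> S) =
    (\<Prod>k\<in>S. if up (k - 1) then c k else 1) * (\<Prod>k\<in>{1..n} - S. if up k then 1 else x ^ 2)"
proof -
  let ?\<pi> = "signed_of \<tau> S"
  define D where "D = {k \<in> {..<n}. if up k then Suc k \<in> S else k \<notin> S}"
  have finS: "finite S" using assms(3) finite_subset by blast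
  have in_S: "1 \<le> k \<and> k \<le> n" if "k \<in> S" for k using assms(3) that by auto
  have up0: "up 0" using permutes_interval_0[OF assms(2)]
      permutes_interval_range[OF assms(2), of 1] assms(1) by (simp add: up_def)
  have upn: "up n" using permutes_interval_Suc[OF assms(2)]
      permutes_interval_range[OF assms(2), of n] assms(1) by (simp add: up_def)
  have "{i \<in> {0..<int n}. ?\<pi> i > ?\<pi> (i + 1)} = int ` D"
    (is "?L = _")
  proof -
    have "i \<in> ?L \<longleftrightarrow> i \<in> int ` D" for i
    proof (cases "i \<ge> 0")
      case True
      then obtain k where i: "i = int k" by (metis nonneg_int_cases)
      then show ?thesis
        using signed_of_descent_iff[OF assms(2,3), of k]
        by (auto simp: D_def up_def)
    qed auto
    then show ?thesis by blast
  qed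
  then have des: "des_B n ?\<pi> = card D"
    by (simp add: des_B_def card_image)
  have s1: "0 < ?\<pi> 1 \<longleftrightarrow> 1 \<notin> S"
    using signed_of_pos[of 1 \<tau> S] permutes_interval_range[OF assms(2), of 1] assms(1) by auto
  have D0: "0 \<in> D \<longleftrightarrow> 1 \<in> S" using up0 assms(1) by (simp add: D_def)
  \<comment> \<open>The index 0 is a descent exactly when the first entry is negative, the case in
    which \<open>fdes\<close> subtracts one. So this descent weighs \<open>x\<close> while all
    others weigh \<open>x ^ 2\<close>.\<close>
  define e where "e k = (if k = (0::nat) then x else x ^ 2)" for k
  have finD: "finite D" by (simp add: D_def)
  have "x ^ fdes n ?\<pi> = (\<Prod>k\<in>D. e k)"
  proof (cases "1 \<in> S")
    case True
    then have "card D = Suc (card (D - {0}))" using D0 finD by (metis card.remove)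
    then have "fdes n ?\<pi> = Suc (2 * card (D - {0}))"
      using True s1 by (simp add: fdes_def des)
    moreover have "(\<Prod>k\<in>D. e k) = e 0 * (\<Prod>k\<in>D - {0}. e k)"
      using True D0 finD by (simp add: prod.remove)
    moreover have "(\<Prod>k\<in>D - {0}. e k) = (\<Prod>k\<in>D - {0}. x ^ 2)"
      by (intro prod.cong) (auto simp: e_def)
    ultimately show ?thesis by (simp add: e_def power_mult)
  next
    case False
    have "(\<Prod>k\<in>D. e k) = (\<Prod>k\<in>D. x ^ 2)"
      using False D0 by (intro prod.cong) (auto simp: e_def)
    then show ?thesis using False s1 by (simp add: fdes_def des power_mult)
  qed
  also have "\<dots> = (\<Prod>k\<in>{k \<in> {..<n}. up k \<and> Suc k \<in> S} \<union> {k \<in> {..<n}. \<not> up k \<and> k \<notin> S}. e k)"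
    by (intro prod.cong) (auto simp: D_def)
  also have "\<dots> = (\<Prod>k\<in>{k \<in> {..<n}. up k \<and> Suc k \<in> S}. e k) *
      (\<Prod>k\<in>{k \<in> {..<n}. \<not> up k \<and> k \<notin> S}. e k)"
    by (intro prod.union_disjoint) auto
  also have "(\<Prod>k\<in>{k \<in> {..<n}. up k \<and> Suc k \<in> S}. e k) = (\<Prod>k\<in>{k \<in> S. up (k - 1)}. c k)"
    using in_S
    by (intro prod.reindex_bij_witness[where i = "\<lambda>k. k - 1" and j = Suc])
      (fastforce simp: e_def c_def)+
  also have "\<dots> = (\<Prod>k\<in>S. if up (k - 1) then c k else 1)"
    using finS by (rule prod.inter_filter)
  also have "(\<Prod>k\<in>{k \<in> {..<n}. \<not> up k \<and> k \<notin> S}. e k) =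
      (\<Prod>k\<in>{k \<in> {1..n} - S. \<not> up k}. x ^ 2)"
  proof (intro prod.cong)
    \<comment> \<open>The two ranges differ only in 0 and \<open>n\<close>, and \<tau> ascends at
      both because \<tau> 0 = 0 and \<tau> (n + 1) = n + 1.\<close>
    show "{k \<in> {..<n}. \<not> up k \<and> k \<notin> S} = {k \<in> {1..n} - S. \<not> up k}"
    proof (rule set_eqI)
      fix k
      show "k \<in> {k \<in> {..<n}. \<not> up k \<and> k \<notin> S} \<longleftrightarrow> k \<in> {k \<in> {1..n} - S. \<not> up k}"
        using up0 upn by (cases "k = 0"; cases "k = n") auto
    qed
  qed (auto simp: e_def)
  also have "\<dots> = (\<Prod>k\<in>{1..n} - S. if \<not> up k then x ^ 2 else 1)"
    by (rule prod.inter_filter) simp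
  also have "\<dots> = (\<Prod>k\<in>{1..n} - S. if up k then 1 else x ^ 2)"
    by (intro prod.cong) auto
  finally show ?thesis .
qed

text \<open>
  The factor \<open>x\<close> pending while the word descends is what balances the weights \<open>2 * x ^ 2\<close> of a peak
  and \<open>2\<close> of a valley to \<open>2 * x\<close> each.
\<close>

lemma prod_turn_weights:
  fixes x :: "'a::comm_ring_1" and up :: "nat \<Rightarrow> bool"
  assumes "up 0" "m \<ge> 1"
  shows "(\<Prod>k = 1..m. (if up (k - 1) then if k = 1 then x else x ^ 2 else 1) +
      (if up k then 1 else x ^ 2)) =
    (1 + x) * (\<Prod>k = 2..m. if up (k - 1) \<noteq> up k then 2 * x else 1 + x ^ 2) *
      (if up m then 1 else x)"
  using assms(2)
proof (induction m rule: dec_induct)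
  case base
  then show ?case using assms(1) by (simp add: algebra_simps power2_eq_square)
next
  case (step m)
  then show ?case by (auto simp: algebra_simps power2_eq_square)
qed

text \<open>The sum over all sign sets is the expansion of a product of two-term factors, one per
  position. The leftover factor of \<open>prod_turn_weights\<close> is 1 because \<tau> ascends at
  \<open>n\<close>.\<close>

lemma sum_power_fdes_signed_of:
  fixes x :: "'a::comm_ring_1"
  assumes "n \<ge> 1" "\<tau> permutes {1..n}"
  shows "(\<Sum>S\<in>Pow {1..n}. x ^ fdes n (signed_of \<tau> S)) =
    (1 + x) * (\<Prod>k = 2..n. if (\<tau> (k - 1) < \<tau> k) \<noteq> (\<tau> k < \<tau> (Suc k)) then 2 * x else 1 + x ^ 2)"
proof -
  let ?up = "\<lambda>k. \<tau> k < \<tau> (Suc k)"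
  have up0: "?up 0" using permutes_interval_0[OF assms(2)]
      permutes_interval_range[OF assms(2), of 1] assms(1) by simp
  have upn: "?up n" using permutes_interval_Suc[OF assms(2)]
      permutes_interval_range[OF assms(2), of n] assms(1) by simp
  have "(\<Sum>S\<in>Pow {1..n}. x ^ fdes n (signed_of \<tau> S)) =
    (\<Sum>S\<in>Pow {1..n}. (\<Prod>k\<in>S. if ?up (k - 1) then if k = 1 then x else x ^ 2 else 1) *
        (\<Prod>k\<in>{1..n} - S. if ?up k then 1 else x ^ 2))"
    using power_fdes_signed_of[OF assms] by (intro sum.cong) auto
  also have "\<dots> = (\<Prod>k\<in>{1..n}. (if ?up (k - 1) then if k = 1 then x else x ^ 2 else 1) +
      (if ?up k then 1 else x ^ 2))"
    by (rule prod_add[symmetric]) simp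
  also have "\<dots> = (1 + x) * (\<Prod>k = 2..n. if ?up (k - 1) \<noteq> ?up k then 2 * x else 1 + x ^ 2)"
    using prod_turn_weights[of ?up, OF up0 assms(1)] upn by simp
  also have "(\<Prod>k = 2..n. if ?up (k - 1) \<noteq> ?up k then 2 * x else 1 + x ^ 2) =
    (\<Prod>k = 2..n. if (\<tau> (k - 1) < \<tau> k) \<noteq> (\<tau> k < \<tau> (Suc k)) then 2 * x else 1 + x ^ 2)"
    by (intro prod.cong) auto
  finally show ?thesis .
qed

section \<open>Reverse-complementation\<close>

text \<open>The reflection of \<open>{0..Suc n}\<close>, continued by the identity to an involution
  of the naturals. It includes 0 and \<open>Suc n\<close> so that conjugation preserves the boundary
  values of a permutation.\<close>

definition flip :: "nat \<Rightarrow> nat \<Rightarrow> nat" where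
  "flip n i = (if i \<le> Suc n then Suc n - i else i)"

lemma flip_flip [simp]: "flip n (flip n i) = i"
  by (simp add: flip_def)

lemma flip_comp_flip: "flip n \<circ> (flip n \<circ> \<tau> \<circ> flip n) \<circ> flip n = \<tau>"
  by (simp add: fun_eq_iff)

lemma flip_comp_permutes:
  assumes "\<tau> permutes {1..n}"
  shows "flip n \<circ> \<tau> \<circ> flip n permutes {1..n}"
proof -
  have "bij (flip n)" by (rule bij_betw_byWitness[where f' = "flip n"]) auto
  then have "bij (flip n \<circ> \<tau> \<circ> flip n)" using permutes_bij[OF assms] by (intro bij_comp)
  moreover have "(flip n \<circ> \<tau> \<circ> flip n) i = i" if "i \<notin> {1..n}" for i
  proof -
    have "flip n i \<notin> {1..n}" using that by (auto simp: flip_def)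
    then have "\<tau> (flip n i) = flip n i" using assms by (simp add: permutes_def)
    then show ?thesis by simp
  qed
  ultimately show ?thesis by (simp add: permutes_def bij_iff)
qed

text \<open>Reversal and complementation each exchange ascents and descents, so together they
  preserve them and only move the place from \<open>k\<close> to \<open>n - k\<close>.\<close>

lemma flip_comp_ascent_iff:
  assumes "\<tau> permutes {1..n}" "k \<le> n"
  shows "(flip n \<circ> \<tau> \<circ> flip n) k < (flip n \<circ> \<tau> \<circ> flip n) (Suc k) \<longleftrightarrow> \<tau> (n - k) < \<tau> (Suc (n - k))"
proof -
  have le: "\<tau> i \<le> Suc n" if "i \<le> Suc n" for i
    using that permutes_interval_0[OF assms(1)] permutes_interval_Suc[OF assms(1)]
      permutes_interval_range[OF assms(1), of i]
    by (cases "i = 0 \<or> i = Suc n") auto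
  have "flip n k = Suc (n - k)" "flip n (Suc k) = n - k" using assms(2) by (auto simp: flip_def)
  then show ?thesis using le[of "n - k"] le[of "Suc (n - k)"] assms(2)
    by (auto simp: flip_def)
qed

text \<open>Sign summation yields turns up to \<open>n\<close>, with the value \<open>Suc n\<close>
  appended on the right, whereas up-down runs use the value 0 on the left. Reverse-complementation
  moves a turn at \<open>k\<close> to \<open>Suc n - k\<close> and so exchanges the
  conventions.\<close>

lemma sum_permutes_turn_weights:
  fixes a b :: "'a::comm_ring_1"
  shows "(\<Sum>\<tau> | \<tau> permutes {1..n}.
      \<Prod>k = 2..n. if (\<tau> (k - 1) < \<tau> k) \<noteq> (\<tau> k < \<tau> (Suc k)) then a else b) =
    (\<Sum>\<tau> | \<tau> permutes {1..n}.
      \<Prod>k = 1..<n. if (\<tau> (k - 1) < \<tau> k) \<noteq> (\<tau> k < \<tau> (Suc k)) then a else b)"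
proof (rule sum.reindex_bij_witness[where i = "\<lambda>\<tau>. flip n \<circ> \<tau> \<circ> flip n"
      and j = "\<lambda>\<tau>. flip n \<circ> \<tau> \<circ> flip n"])
  fix \<tau> assume "\<tau> \<in> {\<tau>. \<tau> permutes {1..n}}"
  then have \<tau>: "\<tau> permutes {1..n}" by simp
  let ?\<sigma> = "flip n \<circ> \<tau> \<circ> flip n"
  show "(\<Prod>k = 1..<n. if (?\<sigma> (k - 1) < ?\<sigma> k) \<noteq> (?\<sigma> k < ?\<sigma> (Suc k)) then a else b) =
    (\<Prod>k = 2..n. if (\<tau> (k - 1) < \<tau> k) \<noteq> (\<tau> k < \<tau> (Suc k)) then a else b)"
  proof (rule prod.reindex_bij_witness[where i = "\<lambda>k. Suc n - k" and j = "\<lambda>k. Suc n - k"])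
    fix k assume k: "k \<in> {1..<n}"
    have 1: "?\<sigma> (k - 1) < ?\<sigma> k \<longleftrightarrow> \<tau> (Suc n - k) < \<tau> (Suc (Suc n - k))"
    proof -
      have "k - 1 \<le> n" "Suc (k - 1) = k" "n - (k - 1) = Suc n - k" using k by auto
      then show ?thesis using flip_comp_ascent_iff[OF \<tau>, of "k - 1"] by presburger
    qed
    have 2: "?\<sigma> k < ?\<sigma> (Suc k) \<longleftrightarrow> \<tau> (Suc n - k - 1) < \<tau> (Suc n - k)"
      using flip_comp_ascent_iff[OF \<tau>, of k] k by (simp add: Suc_diff_le del: o_apply)
    show "(if (\<tau> (Suc n - k - 1) < \<tau> (Suc n - k)) \<noteq>
              (\<tau> (Suc n - k) < \<tau> (Suc (Suc n - k))) then a else b) =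
          (if (?\<sigma> (k - 1) < ?\<sigma> k) \<noteq> (?\<sigma> k < ?\<sigma> (Suc k)) then a else b)"
      unfolding 1 2 by auto
  qed auto
qed (simp_all only: mem_Collect_eq flip_comp_permutes flip_comp_flip)

section \<open>The identity over an arbitrary commutative ring\<close>

text \<open>The extra factor \<open>a\<close> stands for position \<open>n\<close>, which always
  lies in \<open>turns n \<tau>\<close>. With it, the exponent of \<open>a\<close> is the full
  number of turns.\<close>

lemma prod_turn_weights_eq_udr:
  fixes a b :: "'a::comm_ring_1"
  assumes "n \<ge> 1" "\<tau> permutes {1..n}"
  shows "a * (\<Prod>k = 1..<n. if (\<tau> (k - 1) < \<tau> k) \<noteq> (\<tau> k < \<tau> (Suc k)) then a else b) =
    a ^ udr n \<tau> * b ^ (n - udr n \<tau>)"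
proof -
  have sub: "turns n \<tau> \<subseteq> {1..n}" by (auto simp: turns_def)
  have "a ^ udr n \<tau> * b ^ (n - udr n \<tau>) = (\<Prod>k\<in>turns n \<tau>. a) * (\<Prod>k\<in>{1..n} - turns n \<tau>. b)"
    unfolding udr_eq_card_turns[OF assms] using sub
    by (simp add: card_Diff_subset finite_subset)
  also have "\<dots> = (\<Prod>k\<in>{1..n}. if k \<in> turns n \<tau> then a else b)"
    using sub by (subst prod.If_cases) (auto simp: Int_absorb1 Diff_eq)
  also have "{1..n} = insert n {1..<n}" using assms(1) by auto
  also have "(\<Prod>k\<in>insert n {1..<n}. if k \<in> turns n \<tau> then a else b) =
    a * (\<Prod>k\<in>{1..<n}. if k \<in> turns n \<tau> then a else b)"
    using assms(1) by (simp add: turns_def)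
  also have "(\<Prod>k\<in>{1..<n}. if k \<in> turns n \<tau> then a else b) =
    (\<Prod>k = 1..<n. if (\<tau> (k - 1) < \<tau> k) \<noteq> (\<tau> k < \<tau> (Suc k)) then a else b)"
    by (intro prod.cong) (auto simp: turns_def)
  finally show ?thesis by simp
qed

theorem sum_power_fdes_eq_udr:
  fixes x :: "'a::comm_ring_1"
  assumes "n \<ge> 1"
  shows "2 * x * (\<Sum>\<pi>\<in>signed_perms n. x ^ fdes n \<pi>) =
    (1 + x) * (\<Sum>\<tau> | \<tau> permutes {1..n}. (2 * x) ^ udr n \<tau> * (1 + x ^ 2) ^ (n - udr n \<tau>))"
proof -
  let ?w = "\<lambda>\<tau> k. if (\<tau> (k - 1) < \<tau> k) \<noteq> (\<tau> k < \<tau> (Suc k)) then 2 * x else 1 + x ^ 2"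
  have "(\<Sum>\<pi>\<in>signed_perms n. x ^ fdes n \<pi>) =
    (1 + x) * (\<Sum>\<tau> | \<tau> permutes {1..n}. \<Prod>k = 2..n. ?w \<tau> k)"
    unfolding sum_signed_perms sum_distrib_left
    by (intro sum.cong sum_power_fdes_signed_of[OF assms]) auto
  also have "\<dots> = (1 + x) * (\<Sum>\<tau> | \<tau> permutes {1..n}. \<Prod>k = 1..<n. ?w \<tau> k)"
    by (simp only: sum_permutes_turn_weights)
  finally have "2 * x * (\<Sum>\<pi>\<in>signed_perms n. x ^ fdes n \<pi>) =
    (1 + x) * (\<Sum>\<tau> | \<tau> permutes {1..n}. 2 * x * (\<Prod>k = 1..<n. ?w \<tau> k))"
    by (simp only: sum_distrib_left mult_ac)
  also have "(\<Sum>\<tau> | \<tau> permutes {1..n}. 2 * x * (\<Prod>k = 1..<n. ?w \<tau> k)) =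
    (\<Sum>\<tau> | \<tau> permutes {1..n}. (2 * x) ^ udr n \<tau> * (1 + x ^ 2) ^ (n - udr n \<tau>))"
    by (intro sum.cong prod_turn_weights_eq_udr[OF assms]) auto
  finally show ?thesis .
qed

lemma subst_poly_sum_monom:
  "subst_poly (\<Sum>i\<in>A. monom 1 (f i)) x = (\<Sum>i\<in>A. x ^ f i)"
proof -
  have "map_poly of_int (\<Sum>i\<in>A. monom 1 (f i)) = (\<Sum>i\<in>A. monom (1::'a) (f i))"
    by (rule poly_eqI) (auto simp: coeff_map_poly coeff_sum intro!: sum.cong)
  then show ?thesis by (simp add: subst_poly_def poly_sum poly_monom)
qed

lemma udr_le:
  assumes "n \<ge> 1" "\<pi> permutes {1..n}"
  shows "udr n \<pi> \<le> n"
proof -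
  have "card (turns n \<pi>) \<le> card {1..n}" by (rule card_mono) (auto simp: turns_def)
  then show ?thesis by (simp add: udr_eq_card_turns[OF assms])
qed

text \<open>The relation between \<open>x\<close> and \<open>y\<close> expresses y = 2x / (1 + x^2)
  without division, so that one statement serves both identities: x = t in the field of rational
  functions, and x = v, y = t in the ring of power series.\<close>

theorem fdes_poly_eq_udr_poly:
  fixes x y :: "'a::comm_ring_1"
  assumes "n \<ge> 1" "2 * x = y * (1 + x ^ 2)"
  shows "2 * x * subst_poly (fdes_poly n) x = (1 + x) * (1 + x ^ 2) ^ n * subst_poly (udr_poly n) y"
proof -
  have "(2 * x) ^ udr n \<tau> * (1 + x ^ 2) ^ (n - udr n \<tau>) = (1 + x ^ 2) ^ n * y ^ udr n \<tau>"
    if "\<tau> permutes {1..n}" for \<tau>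
  proof -
    have "(1 + x ^ 2) ^ n = (1 + x ^ 2) ^ udr n \<tau> * (1 + x ^ 2) ^ (n - udr n \<tau>)"
      using udr_le[OF assms(1) that] by (simp flip: power_add)
    then show ?thesis unfolding assms(2) by (simp add: power_mult_distrib mult_ac)
  qed
  then show ?thesis
    unfolding fdes_poly_def udr_poly_def subst_poly_sum_monom sum_power_fdes_eq_udr[OF assms(1)]
    by (simp add: sum_distrib_left mult.assoc)
qed

section \<open>Specialization to rational functions and power series\<close>

lemma ratfun_X_nonzero: "ratfun_X \<noteq> 0" "1 + ratfun_X ^ 2 \<noteq> 0" "(2 :: real poly fract) \<noteq> 0"
proof -
  have X: "ratfun_X = to_fract [:0, 1:]"
    by (simp add: ratfun_X_def to_fract_def)
  show "ratfun_X \<noteq> 0"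
    unfolding X by (simp only: to_fract_eq_0_iff) simp
  have "1 + ratfun_X ^ 2 = to_fract (1 + [:0, 1:] * [:0, 1:])"
    unfolding X power2_eq_square by (simp only: to_fract_add to_fract_mult to_fract_1)
  also have "\<dots> \<noteq> 0"
    by (simp only: to_fract_eq_0_iff) (simp add: one_pCons)
  finally show "1 + ratfun_X ^ 2 \<noteq> 0" .
  have "(2 :: real poly fract) = to_fract 1 + to_fract 1"
    by (simp only: to_fract_1 one_add_one)
  also have "\<dots> \<noteq> 0"
    by (simp only: to_fract_eq_0_iff flip: to_fract_add)
  finally show "(2 :: real poly fract) \<noteq> 0" .
qed

text \<open>Squaring 1 - t v = sqrt(1 - t^2) and cancelling \<open>fps_X\<close> twice gives the
  quadratic equation of v, which is the hypothesis of \<open>fdes_poly_eq_udr_poly\<close> with y =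
  t.\<close>

lemma two_v_series: "2 * v_series = fps_X * (1 + v_series ^ 2)"
proof -
  have "(1 - fps_X * v_series) ^ 2 = 1 - fps_X ^ 2"
    using sqrt_series_square by (simp add: v_series_times_X)
  then have "fps_X * (2 * v_series) = fps_X * (fps_X * (1 + v_series ^ 2))"
    by (simp add: power2_eq_square algebra_simps)
  then show ?thesis by simp
qed

lemma v_series_nth_0: "fps_nth v_series 0 = 0"
proof -
  have "fps_nth (2 * v_series) 0 = 0" unfolding two_v_series by simp
  then show ?thesis by simp
qed

theorem corollary4p18:
  fixes n :: nat
  assumes "n \<ge> 1"
  shows "(let t = ratfun_X in
           subst_poly (fdes_poly n) t =
             (1 + t) * (1 + t ^ 2) ^ n / (2 * t) * subst_poly (udr_poly n) (2 * t / (1 + t ^ 2)))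
       \<and> (let v = v_series in
           subst_poly (udr_poly n) fps_X =
             2 * v / ((1 + v) * (1 + v ^ 2) ^ n) * subst_poly (fdes_poly n) v)"
proof -
  have 1: "2 * ratfun_X * subst_poly (fdes_poly n) ratfun_X = (1 + ratfun_X) * (1 + ratfun_X ^ 2) ^ n *
      subst_poly (udr_poly n) (2 * ratfun_X / (1 + ratfun_X ^ 2))"
    by (rule fdes_poly_eq_udr_poly[OF assms]) (simp add: ratfun_X_nonzero)
  define D where "D = (1 + v_series) * (1 + v_series ^ 2) ^ n"
  have "2 * v_series * subst_poly (fdes_poly n) v_series = D * subst_poly (udr_poly n) fps_X"
    unfolding D_def by (rule fdes_poly_eq_udr_poly[OF assms two_v_series])
  \<comment> \<open>Since v has constant term 0, \<open>D\<close> has constant term 1. It is a unit,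
    so dividing by it is multiplication by its inverse.\<close>
  moreover have D0: "fps_nth D 0 \<noteq> 0"
    by (simp add: D_def v_series_nth_0 fps_power_zeroth)
  ultimately have "2 * v_series / D * subst_poly (fdes_poly n) v_series =
      inverse D * D * subst_poly (udr_poly n) fps_X"
    by (simp add: fps_divide_unit mult_ac)
  also have "inverse D * D = 1" using D0 by (rule inverse_mult_eq_1)
  finally have 2: "2 * v_series / D * subst_poly (fdes_poly n) v_series = subst_poly (udr_poly n) fps_X"
    by simp
  show ?thesis
    unfolding Let_def using 1 2 ratfun_X_nonzero by (simp add: D_def field_simps)
qed

end
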